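(* Let $1<\alpha<2$ and $1<\beta<2$, and consider the two-person bimatrix game $(\mathbf U,\mathbf V)$ with $$\mathbf U=\begin{pmatrix}2-\alpha & -(\alpha-1) & -\alpha\\ 1 & 0 & -1\\ \beta & \beta-1 & -(2-\beta)\end{pmatrix},\qquad \mathbf V=\begin{pmatrix}2-\alpha & 1 & \beta\\ -(\alpha-1) & 0 & \beta-1\\ -\alpha & -1 & -(2-\beta)\end{pmatrix}.$$ Let $S\subset\mathbb R^2$ be its NTU-feasible set and take as threat point $(u^*,v^* )=(-(2-\beta),-(2-\beta))$. Then the NTU solution based on the Nash Bargaining Model is $$(\bar u,\bar v)=(2-\alpha,\,2-\alpha);$$ that is, the maximum of $(u-u^* )(v-v^* )=(u+2-\beta)(v+2-\beta)$ over all $(u,v)\in S$ with $u>u^*$ and $v>v^*$ is attained exactly at $(2-\alpha,2-\alpha)$.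
   Context: For a bimatrix game $(\mathbf U,\mathbf V)$, the NTU-feasible set $S$ is the convex hull in $\mathbb R^2$ of the payoff pairs $(u_{ij},v_{ij})$ over all pure strategy pairs $(i,j)$. Given a compact convex set $S$ and a threat point $(u^*,v^* )\in S$ such that some $(u,v)\in S$ has $u>u^*$ and $v>v^*$, the NTU (non-transferable utility) solution based on the Nash Bargaining Model is the unique point $(\bar u,\bar v)\in S$ that maximizes $(u-u^* )(v-v^* )$ over $(u,v)\in S$ with $u>u^*$, $v>v^*$. *)

theory Defs
  imports "HOL-Analysis.Analysis"
begin

text \<open>
  A bimatrix game is a pair of payoff matrices of the same shape; rows are indexed by the pure
  strategies of player I and columns by those of player II.
\<close>

definition ntu_feasible :: "real^'n^'m \<Rightarrow> real^'n^'m \<Rightarrow> (real \<times> real) set" where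
  "ntu_feasible U V = convex hull {(U $ i $ j, V $ i $ j) | i j. True}"

definition bargaining_problem :: "(real \<times> real) set \<Rightarrow> real \<times> real \<Rightarrow> bool" where
  "bargaining_problem S t \<longleftrightarrow>
     compact S \<and> convex S \<and> t \<in> S \<and> (\<exists>p\<in>S. fst p > fst t \<and> snd p > snd t)"

definition improvements :: "(real \<times> real) set \<Rightarrow> real \<times> real \<Rightarrow> (real \<times> real) set" where
  "improvements S t = {p \<in> S. fst p > fst t \<and> snd p > snd t}"

definition nash_product :: "real \<times> real \<Rightarrow> real \<times> real \<Rightarrow> real" where
  "nash_product t p = (fst p - fst t) * (snd p - snd t)"

definition nash_maximizers :: "(real \<times> real) set \<Rightarrow> real \<times> real \<Rightarrow> (real \<times> real) set" where
  "nash_maximizers S t =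
     {p \<in> improvements S t. \<forall>q \<in> improvements S t. nash_product t q \<le> nash_product t p}"

definition is_ntu_solution :: "(real \<times> real) set \<Rightarrow> real \<times> real \<Rightarrow> real \<times> real \<Rightarrow> bool" where
  "is_ntu_solution S t p \<longleftrightarrow> bargaining_problem S t \<and> nash_maximizers S t = {p}"

definition payoff_U :: "real \<Rightarrow> real \<Rightarrow> real^3^3" where
  "payoff_U \<alpha> \<beta> = vector
     [vector [2 - \<alpha>, - (\<alpha> - 1), - \<alpha>],
      vector [1, 0, - 1],
      vector [\<beta>, \<beta> - 1, - (2 - \<beta>)]]"

definition payoff_V :: "real \<Rightarrow> real \<Rightarrow> real^3^3" where
  "payoff_V \<alpha> \<beta> = vector
     [vector [2 - \<alpha>, 1, \<beta>],
      vector [- (\<alpha> - 1), 0, \<beta> - 1],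
      vector [- \<alpha>, - 1, - (2 - \<beta>)]]"

end

theory Submission
  imports Defs
begin

text \<open>
  Since \<open>\<alpha>\<close> and \<open>\<beta>\<close> are below 2, every pure payoff pair lies in the half-plane
  \<open>u + v \<le> 2 * (2 - \<alpha>)\<close>; the corner entries \<open>(- \<alpha>, \<beta>)\<close> and \<open>(\<beta>, - \<alpha>)\<close> do because
  \<open>\<alpha> + \<beta> \<le> 4\<close>. Hence so does the convex hull, and the bounding line passes through the
  diagonal point \<open>(2 - \<alpha>, 2 - \<alpha>)\<close> of the hull. The threat point is on the diagonal as well, so by
  the inequality of arithmetic and geometric means a bound on \<open>u + v\<close> bounds the Nash product,
  with equality only on the diagonal; this is the lemma \<open>is_ntu_solution_diagonal\<close>.
\<close>

lemma finite_payoff_pairs: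
  fixes U V :: "real^'n^'m"
  shows "finite {(U $ i $ j, V $ i $ j) | i j. True}"
proof -
  have "{(U $ i $ j, V $ i $ j) | i j. True} = range (\<lambda>(i, j). (U $ i $ j, V $ i $ j))"
    by auto
  then show ?thesis by simp
qed

lemma compact_ntu_feasible: "compact (ntu_feasible U V)"
  unfolding ntu_feasible_def
  by (intro finite_imp_compact_convex_hull finite_payoff_pairs)

lemma payoff_pair_in_ntu_feasible: "(U $ i $ j, V $ i $ j) \<in> ntu_feasible U V"
  unfolding ntu_feasible_def by (rule hull_inc) blast

lemma ntu_feasible_sum_le:
  assumes "\<And>i j. U $ i $ j + V $ i $ j \<le> b" and "p \<in> ntu_feasible U V"
  shows "fst p + snd p \<le> b"
proof -
  have "ntu_feasible U V \<subseteq> {p. inner (1, 1) p \<le> b}"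
    unfolding ntu_feasible_def
    by (rule hull_minimal) (use assms(1) in \<open>auto simp: convex_halfspace_le\<close>)
  then show ?thesis using assms(2) by (cases p) auto
qed

text \<open>
  With \<open>x = u - c\<close> and \<open>y = v - c\<close>, the identity \<open>4 x y = (x + y)\<^sup>2 - (x - y)\<^sup>2\<close> shows that
  the Nash product falls short of its value at \<open>(d, d)\<close> by at least \<open>((x - y) / 2)\<^sup>2\<close>; a
  maximizer is therefore diagonal, and among diagonal points only \<open>(d, d)\<close> has the maximal value.
\<close>

lemma is_ntu_solution_diagonal:
  fixes c d :: real
  assumes S: "compact S" "convex S" and c: "(c, c) \<in> S" and d: "(d, d) \<in> S" and "c < d"
    and sum_le: "\<And>p. p \<in> S \<Longrightarrow> fst p + snd p \<le> 2 * d"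
  shows "is_ntu_solution S (c, c) (d, d)"
proof -
  have dI: "(d, d) \<in> improvements S (c, c)"
    using d \<open>c < d\<close> by (simp add: improvements_def)
  have gap: "nash_product (c, c) q + ((fst q - snd q) / 2)\<^sup>2 \<le> nash_product (c, c) (d, d)"
    if "q \<in> improvements S (c, c)" for q
  proof -
    have q: "0 \<le> fst q + snd q - 2 * c" "fst q + snd q - 2 * c \<le> 2 * (d - c)"
      using that sum_le[of q] by (auto simp: improvements_def)
    have "(fst q + snd q - 2 * c)\<^sup>2 \<le> (2 * (d - c))\<^sup>2"
      using q by (intro power_mono)
    then show ?thesis
      by (simp add: nash_product_def power2_eq_square field_simps)
  qed
  have max: "nash_product (c, c) q \<le> nash_product (c, c) (d, d)"
    if "q \<in> improvements S (c, c)" for q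
    using gap[OF that] zero_le_power2[of "(fst q - snd q) / 2"] by linarith
  have unique: "q = (d, d)" if "q \<in> nash_maximizers S (c, c)" for q
  proof -
    have qI: "q \<in> improvements S (c, c)"
      and ge: "nash_product (c, c) (d, d) \<le> nash_product (c, c) q"
      using that dI by (auto simp: nash_maximizers_def)
    have "((fst q - snd q) / 2)\<^sup>2 \<le> 0"
      using gap[OF qI] ge by linarith
    then have eq: "fst q = snd q" by simp
    have "(d - c)\<^sup>2 \<le> (fst q - c)\<^sup>2"
      using ge eq by (simp add: nash_product_def power2_eq_square)
    moreover have "0 \<le> fst q - c"
      using qI by (simp add: improvements_def)
    ultimately have "d - c \<le> fst q - c" by (rule power2_le_imp_le)
    moreover have "fst q + snd q \<le> 2 * d"
      using qI sum_le by (simp add: improvements_def)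
    ultimately show ?thesis using eq by (simp add: prod_eq_iff)
  qed
  have "nash_maximizers S (c, c) = {(d, d)}"
    using unique dI max by (auto simp: nash_maximizers_def)
  moreover have "bargaining_problem S (c, c)"
    using S c dI unfolding bargaining_problem_def improvements_def by blast
  ultimately show ?thesis by (simp add: is_ntu_solution_def)
qed

theorem mainTheorem2:
  fixes \<alpha> \<beta> :: real
  assumes "1 < \<alpha>" and "\<alpha> < 2" and "1 < \<beta>" and "\<beta> < 2"
  shows "is_ntu_solution (ntu_feasible (payoff_U \<alpha> \<beta>) (payoff_V \<alpha> \<beta>))
           (- (2 - \<beta>), - (2 - \<beta>)) (2 - \<alpha>, 2 - \<alpha>)"
proof (rule is_ntu_solution_diagonal)
  let ?U = "payoff_U \<alpha> \<beta>" and ?V = "payoff_V \<alpha> \<beta>"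
  show "compact (ntu_feasible ?U ?V)" by (rule compact_ntu_feasible)
  show "convex (ntu_feasible ?U ?V)" by (simp add: ntu_feasible_def convex_convex_hull)
  show "(- (2 - \<beta>), - (2 - \<beta>)) \<in> ntu_feasible ?U ?V"
    using payoff_pair_in_ntu_feasible[of ?U 3 3 ?V] by (simp add: payoff_U_def payoff_V_def)
  show "(2 - \<alpha>, 2 - \<alpha>) \<in> ntu_feasible ?U ?V"
    using payoff_pair_in_ntu_feasible[of ?U 1 1 ?V] by (simp add: payoff_U_def payoff_V_def)
  show "- (2 - \<beta>) < 2 - \<alpha>" using assms by simp
  have "\<forall>i j. ?U $ i $ j + ?V $ i $ j \<le> 2 * (2 - \<alpha>)"
    using assms by (simp add: forall_3 payoff_U_def payoff_V_def)
  then show "fst p + snd p \<le> 2 * (2 - \<alpha>)" if "p \<in> ntu_feasible ?U ?V" for p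
    using ntu_feasible_sum_le that by blast
qed

end
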